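(* (Equivalence of time domain forecasting and frequency domain forecasting.) Assume $x_0, x_1, \dots, x_{N-1}$ and $\hat{x}_0, \hat{x}_1, \dots, \hat{x}_{N-1}, \hat{x}_N$ are the input and output sequences of the frequency model. Then $\hat{x}_N$, transferred from the frequency domain, is the predicted value at timestamp $N$.
   Context: The input $\{x_t \mid t=0,1,\dots,N-1\}$ is a time series in the time domain, where $N$ is the number of discrete timestamps. Its samples are also written $f(x)$, $x=0,\dots,N-1$ (the argument $x$ is the timestamp). The passage to and from the frequency domain is by the discrete Fourier transform and its inverse, $F(u)=\frac{1}{N}\sum_{x=0}^{N-1} f(x)\,e^{-\frac{2\pi i u x}{N}}$ for $u=0,1,\dots,N-1$, and $f(x)=\sum_{u=0}^{N-1}F(u)\,e^{\frac{2\pi i u x}{N}}$ for $x=0,1,\dots,N-1$. The "frequency model" is a forecasting model working in the frequency domain: from the transform of the $N$ input samples it predicts the next frequency-domain value, denoted $F'(N)$, where $F'(u)$, $u=0,\dots,N$, denotes the transform (same normalization, with $N+1$ in place of $N$) of the sequence extended by an $(N+1)$th sample $f(N)$. The output sequence $\hat{x}_0,\dots,\hat{x}_N$, one term longer than the input, is obtained by transferring back to the time domain. The proposition is read as follows: once $F'(N)$ is predicted, the other unknowns, namely the $(N+1)$th sample $f(N)$ and the values $F'(u)$ for $u=0,\dots,N-1$, are determined by $F'(N)$, so that $F'(N)$ is the only variable that needs to be predicted. *)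

theory Defs
  imports Complex_Main
begin

text \<open>
  A finite sequence \<open>x\<^sub>0, \<dots>, x\<^sub>n\<^sub>-\<^sub>1\<close> is a list of length \<open>n\<close>, so the number of samples entering the
  transform is the length of the list. Samples are complex: a real series is a special case,
  while the sample recovered from an arbitrary predicted frequency value need not be real.
  The factor \<open>1/n\<close> belongs to the forward transform.
\<close>

definition dft :: "complex list \<Rightarrow> complex list" where
  "dft f = (let n = length f in
     map (\<lambda>u. 1 / of_nat n *
            (\<Sum>x<n. f ! x * exp (- (2 * of_real pi * \<i> * of_nat u * of_nat x / of_nat n))))
         [0..<n])"

definition idft :: "complex list \<Rightarrow> complex list" where
  "idft F = (let n = length F in
     map (\<lambda>x. \<Sum>u<n. F ! u * exp (2 * of_real pi * \<i> * of_nat u * of_nat x / of_nat n))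
         [0..<n])"

text \<open>
  A frequency model is an arbitrary function \<open>M\<close> that predicts, from the spectrum of the \<open>N\<close> input
  samples, the next frequency value. The unknowns are the sample \<open>y\<close> at timestamp \<open>N\<close>, the spectrum
  \<open>F'\<close> of the extended series of \<open>N + 1\<close> samples, and the output sequence \<open>xhat\<close>. The
  prediction constrains the last entry of \<open>F'\<close> only.
\<close>

definition frequency_forecast ::
  "(complex list \<Rightarrow> complex) \<Rightarrow> complex list \<Rightarrow> complex \<Rightarrow> complex list \<Rightarrow> complex list \<Rightarrow> bool" where
  "frequency_forecast M x y F' xhat \<longleftrightarrow>
     F' = dft (x @ [y]) \<and> F' ! length x = M (dft x) \<and> xhat = idft F'"

end

theory Submission
  imports Defs
begin

text \<open>
  The last frequency value of the extended series is an affine function of the unknown sample, and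
  its slope is \<open>1/(N + 1)\<close> times a value of the exponential, hence nonzero. So the prediction
  determines the sample, and Fourier inversion recovers the extended series.
\<close>

lemma length_dft [simp]: "length (dft f) = length f"
  by (simp add: dft_def Let_def)

lemma length_idft [simp]: "length (idft F) = length F"
  by (simp add: idft_def Let_def)

lemma nth_dft:
  "u < length f \<Longrightarrow> dft f ! u = 1 / of_nat (length f) *
     (\<Sum>x<length f. f ! x *
        exp (- (2 * of_real pi * \<i> * of_nat u * of_nat x / of_nat (length f))))"
  by (simp add: dft_def Let_def)

lemma nth_idft:
  "t < length F \<Longrightarrow> idft F ! t =
     (\<Sum>u<length F. F ! u * exp (2 * of_real pi * \<i> * of_nat u * of_nat t / of_nat (length F)))"
  by (simp add: idft_def Let_def)

text \<open>The summand at \<open>u\<close> is \<open>r ^ u\<close>, where \<open>r\<close> is a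
  quotient of two \<open>n\<close>-th roots of unity. The sum is thus geometric: all its terms are 1
  if \<open>s = t\<close>, and otherwise it vanishes because \<open>r ^ n = 1\<close> while
  \<open>r \<noteq> 1\<close>.\<close>

lemma sum_exp_orthogonal:
  fixes n s t :: nat
  assumes "s < n" "t < n"
  shows "(\<Sum>u<n. exp (- (2 * of_real pi * \<i> * of_nat u * of_nat s / of_nat n)) *
                  exp (2 * of_real pi * \<i> * of_nat u * of_nat t / of_nat n)) =
         (if s = t then of_nat n else (0 :: complex))"
proof -
  define \<zeta> :: "nat \<Rightarrow> complex" where "\<zeta> k = cis (2 * pi * real k / real n)" for k
  have n: "n > 0"
    using assms by simp
  have \<zeta>: "\<zeta> k = exp (2 * of_real pi * \<i> * of_nat k / of_nat n)" for k
    by (simp add: \<zeta>_def cis_conv_exp mult_ac)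
  \<comment> \<open>Used twice: the range gives \<open>\<zeta> k ^ n = 1\<close>, and injectivity
    gives \<open>r \<noteq> 1\<close> for distinct indices below \<open>n\<close>.\<close>
  have bij: "bij_betw \<zeta> {..<n} {z. z ^ n = 1}"
    unfolding \<zeta>_def using bij_betw_roots_unity[OF n] by simp
  have root: "\<zeta> k ^ n = 1" if "k < n" for k
    using bij_betwE[OF bij] that by auto
  have nz: "\<zeta> k \<noteq> 0" for k
    by (simp add: \<zeta>)
  define r where "r = \<zeta> t / \<zeta> s"
  have "exp (- (2 * of_real pi * \<i> * of_nat u * of_nat s / of_nat n)) *
        exp (2 * of_real pi * \<i> * of_nat u * of_nat t / of_nat n) = r ^ u" for u
    by (simp add: r_def \<zeta> exp_minus power_divide field_simps flip: exp_of_nat_mult)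
  then have *: "(\<Sum>u<n. exp (- (2 * of_real pi * \<i> * of_nat u * of_nat s / of_nat n)) *
      exp (2 * of_real pi * \<i> * of_nat u * of_nat t / of_nat n)) = (\<Sum>u<n. r ^ u)"
    by simp
  show ?thesis
  proof (cases "s = t")
    case True
    then show ?thesis
      unfolding * by (simp add: r_def nz)
  next
    case False
    then have "\<zeta> t \<noteq> \<zeta> s"
      using bij assms by (auto simp: bij_betw_def inj_on_def)
    then have "r \<noteq> 1"
      by (simp add: r_def nz)
    moreover have "r ^ n = 1"
      by (simp add: r_def power_divide root assms)
    ultimately show ?thesis
      unfolding * using False by (simp add: geometric_sum)
  qed
qed

text \<open>After the two sums are exchanged, the inner one over frequencies is the orthogonality
  sum. It keeps only \<open>s = t\<close>, where its value \<open>n\<close> cancels the factor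
  \<open>1/n\<close> of the forward transform.\<close>

theorem idft_dft: "idft (dft f) = f"
proof (rule nth_equalityI)
  fix t assume "t < length (idft (dft f))"
  then have t: "t < length f"
    by simp
  define n where "n = length f"
  let ?a = "\<lambda>u s. exp (- (2 * of_real pi * \<i> * of_nat u * of_nat s / of_nat n)) :: complex"
  let ?b = "\<lambda>u. exp (2 * of_real pi * \<i> * of_nat u * of_nat t / of_nat n) :: complex"
  have "idft (dft f) ! t = (\<Sum>u<n. 1 / of_nat n * (\<Sum>s<n. f ! s * ?a u s) * ?b u)"
    using t by (simp add: nth_idft nth_dft n_def)
  also have "\<dots> = (\<Sum>u<n. \<Sum>s<n. 1 / of_nat n * (f ! s * (?a u s * ?b u)))"
    by (simp only: sum_distrib_left sum_distrib_right mult.assoc)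
  also have "\<dots> = (\<Sum>s<n. \<Sum>u<n. 1 / of_nat n * (f ! s * (?a u s * ?b u)))"
    by (rule sum.swap)
  also have "\<dots> = (\<Sum>s<n. 1 / of_nat n * (f ! s * (\<Sum>u<n. ?a u s * ?b u)))"
    by (simp only: sum_distrib_left)
  \<comment> \<open>\<open>mult_exp_exp\<close> would merge the two exponentials, and
    \<open>sum_exp_orthogonal\<close> would no longer match.\<close>
  also have "\<dots> = (\<Sum>s<n. if s = t then f ! s else 0)"
    using t by (intro sum.cong) (auto simp: sum_exp_orthogonal n_def simp del: mult_exp_exp)
  also have "\<dots> = f ! t"
    using t by (simp add: n_def)
  finally show "idft (dft f) ! t = f ! t" .
qed simp

text \<open>The appended sample enters only the summand at \<open>s = length x\<close>. The
  coefficients are chosen before \<open>y\<close>, hence depend on \<open>x\<close> alone, so a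
  prescribed value can be solved for \<open>y\<close>.\<close>

lemma last_dft_snoc_affine:
  "\<exists>A B. B \<noteq> 0 \<and> (\<forall>y. dft (x @ [y]) ! length x = A + B * y)"
proof -
  define e :: "nat \<Rightarrow> complex" where
    "e s = exp (- (2 * of_real pi * \<i> * of_nat (length x) * of_nat s / of_nat (Suc (length x))))"
    for s
  define c :: complex where "c = 1 / of_nat (Suc (length x))"
  have "dft (x @ [y]) ! length x =
      c * (\<Sum>s<length x. x ! s * e s) + c * e (length x) * y" for y
  proof -
    have "dft (x @ [y]) ! length x = c * (\<Sum>s<Suc (length x). (x @ [y]) ! s * e s)"
      by (subst nth_dft) (simp_all only: e_def c_def length_append_singleton lessI)
    also have "\<dots> = c * (\<Sum>s<length x. x ! s * e s) + c * e (length x) * y"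
      by (simp add: nth_append algebra_simps)
    finally show ?thesis .
  qed
  moreover have "c * e (length x) \<noteq> 0"
    \<comment> \<open>Keeping \<open>of_nat (Suc _)\<close> folded leaves the denominator visibly
      nonzero.\<close>
    by (simp add: c_def e_def del: of_nat_Suc)
  ultimately show ?thesis
    by blast
qed

theorem propositionG2:
  fixes N :: nat and x :: "complex list" and M :: "complex list \<Rightarrow> complex"
  assumes "N \<ge> 1" and "length x = N"
  shows "\<exists>y F' xhat. frequency_forecast M x y F' xhat
           \<and> (\<forall>z G w. frequency_forecast M x z G w \<longrightarrow> z = y \<and> G = F' \<and> w = xhat)
           \<and> length xhat = N + 1
           \<and> (\<forall>t<N. xhat ! t = x ! t)
           \<and> xhat ! N = y"
proof -
  obtain A B where B: "B \<noteq> 0" and affine: "\<And>y. dft (x @ [y]) ! length x = A + B * y"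
    using last_dft_snoc_affine by blast
  \<comment> \<open>The unique root of \<open>A + B * y = M (dft x)\<close>.\<close>
  define y where "y = (M (dft x) - A) / B"
  have sample: "dft (x @ [z]) ! length x = M (dft x) \<longleftrightarrow> z = y" for z
    unfolding affine y_def using B by (auto simp: field_simps)
  \<comment> \<open>One equivalence yields both existence and uniqueness. By inversion the output is
    \<open>x @ [y]\<close>, from which its length and entries are read off.\<close>
  have "frequency_forecast M x z G w \<longleftrightarrow> z = y \<and> G = dft (x @ [y]) \<and> w = x @ [y]" for z G w
    unfolding frequency_forecast_def using sample by (auto simp: idft_dft)
  then show ?thesis
    using assms(2) by (intro exI[of _ y] exI[of _ "dft (x @ [y])"] exI[of _ "x @ [y]"])
      (auto simp: nth_append)
qed

end
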